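(* For all $\tau\in\mathbb{H}$: (1) $g(\tau)^5-g(5\tau)-5g(\tau)g(5\tau)P(g(\tau),g(5\tau))=25g(\tau)^2g(5\tau)^2Q(g(\tau),g(5\tau))$, where $P(X,Y)=Y+11X^3-12X^2+7X-2$ and $Q(X,Y)=25X^2Y^3-5X(10X-1)Y^2+(35X^2-10X+1)Y-12X^2+7X-2$; (2) $U(\tau)^5-U(5\tau)=5U(\tau)U(5\tau)R(U(\tau),U(5\tau))$, where $R(X,Y)=(5Y^4-5Y^2+1)X^3-Y(5Y^2-3)X^2+(3Y^2-1)X-Y$.
   Context: $q=e^{2\pi i\tau}$, $q^r=e^{2\pi i r\tau}$ for rational $r$, $(a;q)_\infty=\prod_{k\ge0}(1-aq^k)$, $\eta(\tau)=q^{1/24}(q;q)_\infty$. $g(\tau)=\dfrac{\eta^2(2\tau)\eta^4(5\tau)}{\eta^4(\tau)\eta^2(10\tau)}$. $U(\tau)=I(\tau)/J(\tau)$ where $I(\tau)=q^{3/4}\dfrac{(q;q^{10})_\infty(q^9;q^{10})_\infty}{(q^4;q^{10})_\infty(q^6;q^{10})_\infty}$ and $J(\tau)=q^{1/4}\dfrac{(q^2;q^{10})_\infty(q^8;q^{10})_\infty}{(q^3;q^{10})_\infty(q^7;q^{10})_\infty}$. *)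

theory Defs
  imports "HOL-Analysis.Analysis"
begin

definition qpow :: "real \<Rightarrow> complex \<Rightarrow> complex" where
  "qpow r \<tau> = exp (2 * of_real pi * \<i> * of_real r * \<tau>)"

definition qpoch_inf :: "complex \<Rightarrow> complex \<Rightarrow> complex" where
  "qpoch_inf a q = (\<Prod>k. (1 - a * q ^ k))"

definition dedekind_eta :: "complex \<Rightarrow> complex" where
  "dedekind_eta \<tau> = qpow (1/24) \<tau> * qpoch_inf (qpow 1 \<tau>) (qpow 1 \<tau>)"

definition g_fun :: "complex \<Rightarrow> complex" where
  "g_fun \<tau> = (dedekind_eta (2*\<tau>) ^ 2 * dedekind_eta (5*\<tau>) ^ 4) /
              (dedekind_eta \<tau> ^ 4 * dedekind_eta (10*\<tau>) ^ 2)"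

definition I_fun :: "complex \<Rightarrow> complex" where
  "I_fun \<tau> = qpow (3/4) \<tau> *
     (qpoch_inf (qpow 1 \<tau>) (qpow 10 \<tau>) * qpoch_inf (qpow 9 \<tau>) (qpow 10 \<tau>)) /
     (qpoch_inf (qpow 4 \<tau>) (qpow 10 \<tau>) * qpoch_inf (qpow 6 \<tau>) (qpow 10 \<tau>))"

definition J_fun :: "complex \<Rightarrow> complex" where
  "J_fun \<tau> = qpow (1/4) \<tau> *
     (qpoch_inf (qpow 2 \<tau>) (qpow 10 \<tau>) * qpoch_inf (qpow 8 \<tau>) (qpow 10 \<tau>)) /
     (qpoch_inf (qpow 3 \<tau>) (qpow 10 \<tau>) * qpoch_inf (qpow 7 \<tau>) (qpow 10 \<tau>))"

definition U_fun :: "complex \<Rightarrow> complex" where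
  "U_fun \<tau> = I_fun \<tau> / J_fun \<tau>"

definition P_poly :: "complex \<Rightarrow> complex \<Rightarrow> complex" where
  "P_poly X Y = Y + 11 * X^3 - 12 * X^2 + 7 * X - 2"

definition Q_poly :: "complex \<Rightarrow> complex \<Rightarrow> complex" where
  "Q_poly X Y = 25 * X^2 * Y^3 - 5 * X * (10 * X - 1) * Y^2
     + (35 * X^2 - 10 * X + 1) * Y - 12 * X^2 + 7 * X - 2"

definition R_poly :: "complex \<Rightarrow> complex \<Rightarrow> complex" where
  "R_poly X Y = (5 * Y^4 - 5 * Y^2 + 1) * X^3 - Y * (5 * Y^2 - 3) * X^2
     + (3 * Y^2 - 1) * X - Y"

end

theory Submission
  imports Defs
begin

text \<open>
  Let \<open>\<theta>(p)\<close> be the sum of \<open>w(x) p^(x\<^sup>2)\<close> over the integers, where \<open>w(x)\<close> depends only on the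
  parity of \<open>x\<close>. By the Jacobi triple product, \<open>U(\<tau>) = \<theta>(p\<^sup>5) / \<theta>(p)\<close> for
  \<open>w = (0, 1)\<close> and \<open>p = q^(1/8)\<close>, and \<open>g(\<tau>) = (\<theta>(q\<^sup>5) / \<theta>(q))\<^sup>2\<close> for \<open>w = (1, -1)\<close>.
  Sorting by \<open>x mod 5\<close> gives \<open>\<theta>(p) = \<theta>(p^25) + A + B\<close>, and since 5 is the norm of
  \<open>2 - \<i>\<close>, rotating the lattice of pairs shows \<open>A B = \<theta>(p\<^sup>5)\<^sup>2 - \<theta>(p^25)\<^sup>2\<close>. For a fifth root of unity
  \<open>\<zeta>\<close> one has \<open>\<theta>(\<zeta> p) = \<theta>(p^25) + \<zeta> A + \<zeta>\<^sup>4 B\<close>, while the infinite products give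
  \<open>\<theta>(p\<^sup>5)\<^sup>6 / \<theta>(p^25)\<close> for the product of these over all \<open>\<zeta>\<close>. Eliminating \<open>A\<close> and \<open>B\<close> leaves the
  same quintic relation for both choices of \<open>w\<close>; the equation for \<open>g\<close> follows on passing to squares.
\<close>

subsection \<open>Infinite q-products\<close>

lemma convergent_prod_qpoch:
  assumes "norm q < 1"
  shows "convergent_prod (\<lambda>k. 1 - a * q ^ k :: complex)"
proof -
  have "summable (\<lambda>k. norm a * norm q ^ k)"
    using assms by (intro summable_mult summable_geometric) auto
  then have "summable (\<lambda>k. norm ((1 - a * q ^ k) - 1))"
    by (simp add: norm_mult norm_power)
  then show ?thesis
    by (intro abs_convergent_prod_imp_convergent_prod) (simp add: abs_convergent_prod_conv_summable)
qed

lemma qpoch_inf_LIMSEQ: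
  assumes "norm q < 1"
  shows "(\<lambda>n. \<Prod>k<n. 1 - a * q ^ k) \<longlonglongrightarrow> qpoch_inf a q"
proof -
  have "(\<lambda>n. \<Prod>k\<le>n. 1 - a * q ^ k) \<longlonglongrightarrow> qpoch_inf a q"
    unfolding qpoch_inf_def by (rule convergent_prod_LIMSEQ[OF convergent_prod_qpoch[OF assms]])
  then have "(\<lambda>n. \<Prod>k<Suc n. 1 - a * q ^ k) \<longlonglongrightarrow> qpoch_inf a q"
    by (simp only: lessThan_Suc_atMost)
  then show ?thesis
    by (rule LIMSEQ_imp_Suc)
qed

lemma norm_mult_power_less_1:
  fixes a q :: complex
  assumes "norm a < 1" "norm q < 1"
  shows "norm (a * q ^ k) < 1"
proof -
  have "norm q ^ k \<le> 1"
    using assms by (intro power_le_one) auto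
  then have "norm a * norm q ^ k \<le> norm a"
    by (simp add: mult_left_le)
  then show ?thesis
    using assms by (simp add: norm_mult norm_power)
qed

lemma qpoch_inf_nonzero:
  assumes "norm a < 1" "norm q < 1"
  shows "qpoch_inf a q \<noteq> 0"
  unfolding qpoch_inf_def
proof (rule prodinf_nonzero[OF convergent_prod_qpoch[OF assms(2)]])
  show "1 - a * q ^ k \<noteq> 0" for k
    using norm_mult_power_less_1[OF assms, of k] by (metis norm_one less_irrefl right_minus_eq)
qed

lemma prod_lessThan_add:
  fixes f :: "nat \<Rightarrow> 'a :: comm_monoid_mult"
  shows "(\<Prod>k<m+n. f k) = (\<Prod>k<m. f k) * (\<Prod>k<n. f (m + k))"
  by (induction n) (simp_all add: mult.assoc)

text \<open>The factors are sorted by \<open>k mod m\<close>. For partial products with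
  \<open>n * m\<close> factors this is a finite rearrangement; the limit is then taken along that
  subsequence.\<close>

lemma qpoch_inf_multisection:
  assumes "norm q < 1" "m > 0"
  shows "qpoch_inf a q = (\<Prod>r<m. qpoch_inf (a * q ^ r) (q ^ m))"
proof (rule LIMSEQ_unique)
  show "(\<lambda>n. \<Prod>k<n*m. 1 - a * q ^ k) \<longlonglongrightarrow> qpoch_inf a q"
    using LIMSEQ_subseq_LIMSEQ[OF qpoch_inf_LIMSEQ[OF assms(1)], of "\<lambda>n. n * m"] assms(2)
    by (simp add: strict_mono_def o_def)
  have "(\<Prod>k<n*m. 1 - a * q ^ k) = (\<Prod>r<m. \<Prod>k<n. 1 - a * q ^ r * (q ^ m) ^ k)" for n
  proof (induction n)
    case (Suc n)
    have "(\<Prod>k<Suc n*m. 1 - a * q ^ k) = (\<Prod>k<n*m+m. 1 - a * q ^ k)"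
      by (simp add: add.commute)
    also have "\<dots> = (\<Prod>k<n*m. 1 - a * q ^ k) * (\<Prod>k<m. 1 - a * q ^ (n*m+k))"
      by (rule prod_lessThan_add)
    finally show ?case
      unfolding Suc by (simp add: prod.distrib power_add power_mult mult_ac)
  qed simp
  moreover have "(\<lambda>n. \<Prod>r<m. \<Prod>k<n. 1 - a * q ^ r * (q ^ m) ^ k)
      \<longlonglongrightarrow> (\<Prod>r<m. qpoch_inf (a * q ^ r) (q ^ m))"
    using assms by (intro tendsto_prod qpoch_inf_LIMSEQ) (auto simp: norm_power power_less_one_iff)
  ultimately show "(\<lambda>n. \<Prod>k<n*m. 1 - a * q ^ k) \<longlonglongrightarrow> (\<Prod>r<m. qpoch_inf (a * q ^ r) (q ^ m))"
    by simp
qed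

lemma qpoch_inf_mult_uminus:
  assumes "norm q < 1"
  shows "qpoch_inf a q * qpoch_inf (- a) q = qpoch_inf (a\<^sup>2) (q\<^sup>2)"
proof -
  have "(1 - a * q ^ k) * (1 - (- a) * q ^ k) = 1 - a\<^sup>2 * (q\<^sup>2) ^ k" for k
    by (simp add: algebra_simps power2_eq_square power_mult_distrib)
  then show ?thesis
    unfolding qpoch_inf_def by (simp only: prodinf_mult convergent_prod_qpoch assms)
qed

text \<open>The eta function without its factor \<open>q^(1/24)\<close>. As a function of
  \<open>q\<close> rather than of \<tau>, it allows \<open>q\<close> to be multiplied by a root of
  unity.\<close>

definition euler_phi :: "complex \<Rightarrow> complex" where
  "euler_phi q = qpoch_inf q q"

lemma euler_phi_nonzero: "norm q < 1 \<Longrightarrow> euler_phi q \<noteq> 0"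
  by (simp add: euler_phi_def qpoch_inf_nonzero)

section \<open>Products over the fifth roots of unity\<close>

lemma norm_root_of_unity_5:
  fixes \<zeta> :: complex
  assumes "\<zeta> ^ 5 = 1"
  shows "norm \<zeta> = 1"
  using power_eq_imp_eq_base[of "norm \<zeta>" 5 1] assms by (simp flip: norm_power)

lemma sum_root_of_unity_5:
  fixes \<zeta> :: complex
  assumes "\<zeta> ^ 5 = 1" "\<zeta> \<noteq> 1"
  shows "1 + \<zeta> + \<zeta>^2 + \<zeta>^3 + \<zeta>^4 = 0"
proof -
  have "(\<zeta> - 1) * (1 + \<zeta> + \<zeta>^2 + \<zeta>^3 + \<zeta>^4) = 0"
    using assms(1) by (simp add: algebra_simps eval_nat_numeral)
  then show ?thesis
    using assms(2) by simp
qed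

lemma prod_root_of_unity_5:
  fixes \<zeta> x :: complex
  assumes "\<zeta> ^ 5 = 1" "\<zeta> \<noteq> 1"
  shows "(\<Prod>j<5. 1 - \<zeta> ^ j * x) = 1 - x ^ 5"
proof -
  have "1 + \<zeta> + \<zeta>^2 + \<zeta>^3 + \<zeta>^4 = 0"
    using assms by (rule sum_root_of_unity_5)
  then have "(1 - x) * (1 - \<zeta> * x) * (1 - \<zeta>^2 * x) * (1 - \<zeta>^3 * x) * (1 - \<zeta>^4 * x) = 1 - x ^ 5"
    by algebra
  then show ?thesis
    by (simp add: eval_nat_numeral mult_ac)
qed

lemma power_root_of_unity_5_neq_1:
  fixes \<zeta> :: complex
  assumes "\<zeta> ^ 5 = 1" "\<zeta> \<noteq> 1" "r mod 5 \<noteq> 0"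
  shows "\<zeta> ^ r \<noteq> 1"
proof
  assume r: "\<zeta> ^ r = 1"
  have "r mod 5 < 5"
    by simp
  then have "r mod 5 = 1 \<or> r mod 5 = 2 \<or> r mod 5 = 3 \<or> r mod 5 = 4"
    using assms(3) by linarith
  \<comment> \<open>The multipliers 1, 3, 2, 4 are the inverses of 1, 2, 3, 4 modulo 5. Hence
    \<zeta> itself is a power of \<open>\<zeta> ^ r\<close>.\<close>
  then have "(r mod 5 * 1) mod 5 = 1 \<or> (r mod 5 * 3) mod 5 = 1 \<or> (r mod 5 * 2) mod 5 = 1
      \<or> (r mod 5 * 4) mod 5 = 1"
    by (elim disjE) simp_all
  then have "\<exists>u. (r mod 5 * u) mod 5 = 1"
    by blast
  then obtain u where "(r * u) mod 5 = 1"
    by (auto simp: mod_mult_left_eq)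
  then have "r * u = 5 * (r * u div 5) + 1"
    by (metis mult_div_mod_eq)
  then have "(\<zeta> ^ r) ^ u = (\<zeta> ^ 5) ^ (r * u div 5) * \<zeta>"
    by (metis power_add power_mult power_one_right)
  then show False
    using assms r by simp
qed

lemma prod_qpoch_inf_root_of_unity_5:
  fixes \<zeta> :: complex
  assumes "\<zeta> ^ 5 = 1" "\<zeta> \<noteq> 1" "norm q < 1"
  shows "(\<Prod>j<5. qpoch_inf (\<zeta> ^ j * a) q) = qpoch_inf (a ^ 5) (q ^ 5)"
proof -
  have "(\<Prod>j<5. qpoch_inf (\<zeta> ^ j * a) q) = (\<Prod>k. \<Prod>j<5. 1 - \<zeta> ^ j * a * q ^ k)"
    unfolding qpoch_inf_def by (rule prodinf_prod [symmetric]) (rule convergent_prod_qpoch[OF assms(3)])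
  also have "\<dots> = (\<Prod>k. 1 - (a * q ^ k) ^ 5)"
    by (subst prod_root_of_unity_5[OF assms(1,2), symmetric]) (simp add: mult.assoc)
  also have "\<dots> = qpoch_inf (a ^ 5) (q ^ 5)"
    by (simp add: qpoch_inf_def power_mult_distrib power_mult [symmetric] mult.commute)
  finally show ?thesis .
qed

text \<open>Split the factors \<open>1 - q^n\<close> by \<open>n mod 5\<close>. Those with
  \<open>n\<close> divisible by 5 do not see \<zeta> and contribute
  \<open>euler_phi (q^5)^5\<close>. In a class \<open>r \<noteq> 0\<close> the root
  \<open>\<zeta>^r\<close> is again primitive, so the product over \<open>j\<close> turns
  \<open>(q^r; q^5)\<close> into \<open>(q^(5r); q^25)\<close>. These four classes together give
  \<open>euler_phi (q^5) / euler_phi (q^25)\<close>.\<close>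

lemma prod_euler_phi_root_of_unity_5:
  fixes \<zeta> :: complex
  assumes "\<zeta> ^ 5 = 1" "\<zeta> \<noteq> 1" "norm q < 1"
  shows "(\<Prod>j<5. euler_phi (\<zeta> ^ j * q)) * euler_phi (q ^ 25) = euler_phi (q ^ 5) ^ 6"
proof -
  have norm_\<zeta>: "norm \<zeta> = 1"
    using assms(1) by (rule norm_root_of_unity_5)
  have q5: "norm (q ^ 5) < 1"
    using assms(3) by (simp add: norm_power power_less_one_iff)
  have multi: "euler_phi x = (\<Prod>r<4. qpoch_inf (x ^ Suc r) (x ^ 5)) * euler_phi (x ^ 5)"
    if "norm x < 1" for x
  proof -
    have "euler_phi x = (\<Prod>r<Suc 4. qpoch_inf (x ^ Suc r) (x ^ 5))"
      using qpoch_inf_multisection[OF that, of 5 x] by (simp add: euler_phi_def)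
    then show ?thesis
      by (simp add: euler_phi_def eval_nat_numeral)
  qed
  have \<zeta>5: "(\<zeta> ^ j * q) ^ 5 = q ^ 5" for j
    by (simp add: power_mult_distrib flip: power_mult) (simp add: mult.commute[of j] power_mult assms(1))
  have "(\<Prod>j<5. euler_phi (\<zeta> ^ j * q))
      = (\<Prod>j<5. (\<Prod>r<4. qpoch_inf ((\<zeta> ^ j * q) ^ Suc r) (q ^ 5)) * euler_phi (q ^ 5))"
    by (intro prod.cong refl, subst multi)
       (simp_all add: \<zeta>5 norm_mult norm_power norm_\<zeta> assms(3) del: power_Suc)
  also have "\<dots> = (\<Prod>r<4. \<Prod>j<5. qpoch_inf ((\<zeta> ^ j * q) ^ Suc r) (q ^ 5)) * euler_phi (q ^ 5) ^ 5"
    by (subst prod.swap) (simp add: prod.distrib)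
  also have "(\<Prod>r<4. \<Prod>j<5. qpoch_inf ((\<zeta> ^ j * q) ^ Suc r) (q ^ 5))
      = (\<Prod>r<4. \<Prod>j<5. qpoch_inf ((\<zeta> ^ Suc r) ^ j * q ^ Suc r) (q ^ 5))"
    by (simp add: power_mult_distrib power_mult [symmetric] mult.commute del: power_Suc)
  also have "\<dots> = (\<Prod>r<4. qpoch_inf ((q ^ 5) ^ Suc r) ((q ^ 5) ^ 5))"
  proof (intro prod.cong refl)
    fix r :: nat assume "r \<in> {..<4}"
    then have "\<zeta> ^ Suc r \<noteq> 1"
      by (intro power_root_of_unity_5_neq_1[OF assms(1,2)]) auto
    moreover have "(\<zeta> ^ Suc r) ^ 5 = 1"
      by (metis assms(1) mult.commute power_mult power_one)
    ultimately show "(\<Prod>j<5. qpoch_inf ((\<zeta> ^ Suc r) ^ j * q ^ Suc r) (q ^ 5))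
        = qpoch_inf ((q ^ 5) ^ Suc r) ((q ^ 5) ^ 5)"
      by (subst prod_qpoch_inf_root_of_unity_5)
         (use q5 in \<open>simp_all add: power_mult [symmetric] mult.commute del: power_Suc\<close>)
  qed
  finally have "(\<Prod>j<5. euler_phi (\<zeta> ^ j * q)) =
      (\<Prod>r<4. qpoch_inf ((q ^ 5) ^ Suc r) ((q ^ 5) ^ 5)) * euler_phi (q ^ 5) ^ 5" .
  moreover have "(q ^ 5) ^ 5 = q ^ 25"
    by (simp add: power_mult [symmetric])
  ultimately show ?thesis
    using multi[OF q5] by (simp only: power_mult_distrib) (simp add: eval_nat_numeral)
qed

subsection \<open>The Jacobi triple product\<close>

definition qfact :: "complex \<Rightarrow> nat \<Rightarrow> complex" where
  "qfact q n = (\<Prod>k<n. 1 - q ^ Suc k)"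

text \<open>The q-Pascal recursion avoids division, so it makes sense for every \<open>q\<close>. Of
  the two such rules, this one matches the appending of a last factor \<open>1 + x * q ^ n\<close>
  in Rothe's product. Truncation of \<open>n - k\<close> is harmless, since
  \<open>gauss_binomial q n k\<close> vanishes for \<open>k > n\<close>.\<close>

fun gauss_binomial :: "complex \<Rightarrow> nat \<Rightarrow> nat \<Rightarrow> complex" where
  "gauss_binomial q n 0 = 1"
| "gauss_binomial q 0 (Suc k) = 0"
| "gauss_binomial q (Suc n) (Suc k) = gauss_binomial q n (Suc k) + q ^ (n - k) * gauss_binomial q n k"

lemma gauss_binomial_eq_0: "n < k \<Longrightarrow> gauss_binomial q n k = 0"
  by (induction q n k rule: gauss_binomial.induct) auto

text \<open>The Pascal rule reduces this to
  \<open>1 - q^(k+m) = (1 - q^m) + q^m * (1 - q^k)\<close>. Kept free of division, the formula holds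
  also where \<open>qfact\<close> vanishes.\<close>

lemma gauss_binomial_mult_qfact:
  "gauss_binomial q (k + m) k * qfact q k * qfact q m = qfact q (k + m)"
proof (induction "k + m" arbitrary: k m)
  case 0
  then show ?case by (simp add: qfact_def)
next
  case (Suc n)
  show ?case
  proof (cases k)
    case 0
    then show ?thesis by (simp add: qfact_def)
  next
    case k: (Suc k')
    show ?thesis
    proof (cases m)
      case 0
      have "gauss_binomial q (k' + 0) k' * qfact q k' * qfact q 0 = qfact q (k' + 0)"
        by (rule Suc(1)) (use Suc(2) k 0 in auto)
      then show ?thesis using k 0
        by (simp add: gauss_binomial_eq_0 qfact_def mult_ac)
    next
      case m: (Suc m')
      have *: "gauss_binomial q (k + m') k * qfact q k * qfact q m' = qfact q (k + m')"
        by (rule Suc(1)) (use Suc(2) k m in auto)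
      have **: "gauss_binomial q (k' + m) k' * qfact q k' * qfact q m = qfact q (k' + m)"
        by (rule Suc(1)) (use Suc(2) k m in auto)
      have step: "qfact q (Suc j) = qfact q j * (1 - q ^ Suc j)" for j
        by (simp add: qfact_def)
      define A where "A = gauss_binomial q (k + m') k"
      define B where "B = gauss_binomial q (k' + m) k'"
      have distrib: "(A + v * B) * c * d = A * c * d' * (1 - v) + v * (B * c' * d) * (1 - u)"
        if "c = c' * (1 - u)" "d = d' * (1 - v)" for c c' u d d' v
        using that by algebra
      have "gauss_binomial q (k + m) k = A + q ^ m * B"
        using k m by (simp add: A_def B_def)
      moreover have "qfact q k = qfact q k' * (1 - q ^ k)" "qfact q m = qfact q m' * (1 - q ^ m)"
        "qfact q (k + m) = qfact q (k' + m) * (1 - q ^ (k + m))" 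
        using step[of k'] step[of m'] step[of "k' + m"] k m by simp_all
      moreover have "k + m' = k' + m"
        using k m by simp
      ultimately have "gauss_binomial q (k + m) k * qfact q k * qfact q m
          = A * qfact q k * qfact q m' * (1 - q ^ m) + q ^ m * (B * qfact q k' * qfact q m) * (1 - q ^ k)"
        using distrib[of "qfact q k" "qfact q k'" "q ^ k" "qfact q m" "qfact q m'" "q ^ m"] by simp
      also have "\<dots> = qfact q (k' + m) * (1 - q ^ m) + q ^ m * qfact q (k' + m) * (1 - q ^ k)"
        using * ** \<open>k + m' = k' + m\<close> unfolding A_def B_def by simp
      also have "\<dots> = qfact q (k + m)"
        unfolding \<open>qfact q (k + m) = _\<close> by (simp add: algebra_simps power_add)
      finally show ?thesis .
    qed
  qed
qed

text \<open>Induction by splitting off the last factor: the weight \<open>q ^ (n - k)\<close> of the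
  Pascal rule combines with \<open>q ^ (Suc k choose 2)\<close> to
  \<open>q ^ n * q ^ (k choose 2)\<close>.\<close>

lemma rothe_identity:
  "(\<Prod>k<n. 1 + x * q ^ k) = (\<Sum>k\<le>n. gauss_binomial q n k * q ^ (k choose 2) * x ^ k)"
proof (induction n)
  case (Suc n)
  define c where "c = (\<lambda>k. gauss_binomial q n k * q ^ (k choose 2) * x ^ k)"
  have c0: "c (Suc n) = 0"
    by (simp add: c_def gauss_binomial_eq_0)
  have "gauss_binomial q (Suc n) (Suc k) * q ^ (Suc k choose 2) * x ^ Suc k = c (Suc k) + x * q ^ n * c k"
    if "k \<le> n" for k
  proof -
    have "q ^ (n - k) * q ^ (Suc k choose 2) = q ^ n * q ^ (k choose 2)"
      using that by (simp add: numeral_2_eq_2 flip: power_add)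
    then show ?thesis
      unfolding c_def by (simp add: algebra_simps)
  qed
  then have "(\<Sum>k\<le>Suc n. gauss_binomial q (Suc n) k * q ^ (k choose 2) * x ^ k)
      = c 0 + (\<Sum>k\<le>n. c (Suc k) + x * q ^ n * c k)"
    by (subst sum.atMost_Suc_shift) (simp add: c_def)
  also have "\<dots> = (\<Sum>k\<le>Suc n. c k) + x * q ^ n * (\<Sum>k\<le>n. c k)"
    by (subst sum.atMost_Suc_shift) (simp add: sum.distrib sum_distrib_left)
  also have "\<dots> = (1 + x * q ^ n) * (\<Sum>k\<le>n. c k)"
    by (simp add: c0 algebra_simps)
  finally show ?case
    by (simp add: Suc c_def mult.commute)
qed (simp add: numeral_2_eq_2)

text \<open>Rothe's identity with base \<open>q^2\<close> and \<open>2 * n\<close> factors, started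
  at \<open>x = z * q^(1 - 2n)\<close>. The last \<open>n\<close> factors form the first product;
  the first \<open>n\<close>, read backwards, form the second up to the monomial \<open>s\<close>.
  Shifting the summation index by \<open>n\<close> makes the range symmetric.\<close>

lemma finite_jacobi_triple_product:
  fixes q z :: complex
  assumes [simp]: "q \<noteq> 0" "z \<noteq> 0"
  shows "(\<Prod>k<n. 1 + z * q * (q\<^sup>2) ^ k) * (\<Prod>k<n. 1 + q / z * (q\<^sup>2) ^ k)
    = (\<Sum>j\<in>{-int n..int n}. gauss_binomial (q\<^sup>2) (2*n) (nat (int n + j)) * (z powi j * q ^ nat (j\<^sup>2)))"
proof -
  define x where "x = z * q / (q\<^sup>2) ^ n"
  define s where "s = z ^ n / q ^ (n\<^sup>2)"
  have s: "s \<noteq> 0" 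
    by (simp add: s_def)
  have "(\<Prod>k<n. 1 + x * (q\<^sup>2) ^ k) = s * (\<Prod>k<n. 1 + q / z * (q\<^sup>2) ^ k)"
  proof -
    have "(\<Prod>k<n. 1 + x * (q\<^sup>2) ^ k) = (\<Prod>k<n. 1 + x * (q\<^sup>2) ^ (n - Suc k))"
      by (rule prod.nat_diff_reindex [symmetric])
    also have "\<dots> = (\<Prod>k<n. z / q ^ (2 * k + 1) * (1 + q / z * (q\<^sup>2) ^ k))"
    proof (intro prod.cong refl)
      fix k assume "k \<in> {..<n}"
      then have "(q\<^sup>2) ^ n = (q\<^sup>2) ^ (n - Suc k) * (q\<^sup>2) ^ Suc k"
        by (simp flip: power_add del: power_Suc)
      then have "x * (q\<^sup>2) ^ (n - Suc k) = z * q / (q\<^sup>2) ^ Suc k"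
        by (simp add: x_def)
      then show "1 + x * (q\<^sup>2) ^ (n - Suc k) = z / q ^ (2 * k + 1) * (1 + q / z * (q\<^sup>2) ^ k)"
        by (simp add: field_simps power_mult power2_eq_square)
    qed
    also have "\<dots> = (\<Prod>k<n. z / q ^ (2 * k + 1)) * (\<Prod>k<n. 1 + q / z * (q\<^sup>2) ^ k)"
      by (rule prod.distrib)
    \<comment> \<open>The odd numbers from 1 to \<open>2 * n - 1\<close> add up to
      \<open>n^2\<close>.\<close>
    also have "(\<Prod>k<n. z / q ^ (2 * k + 1)) = s"
      unfolding s_def by (induction n) (simp_all add: field_simps power2_eq_square power_add power_mult)
    finally show ?thesis .
  qed
  moreover have "x * (q\<^sup>2) ^ (n + k) = z * q * (q\<^sup>2) ^ k" for k
    by (simp add: x_def power_add)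
  ultimately have "(\<Prod>k<2*n. 1 + x * (q\<^sup>2) ^ k)
      = s * ((\<Prod>k<n. 1 + z * q * (q\<^sup>2) ^ k) * (\<Prod>k<n. 1 + q / z * (q\<^sup>2) ^ k))"
    unfolding mult_2 prod_lessThan_add by simp
  moreover have "(\<Prod>k<2*n. 1 + x * (q\<^sup>2) ^ k)
      = s * (\<Sum>j\<in>{-int n..int n}. gauss_binomial (q\<^sup>2) (2*n) (nat (int n + j)) * (z powi j * q ^ nat (j\<^sup>2)))"
    unfolding rothe_identity sum_distrib_left
  proof (rule sum.reindex_bij_witness[of _ "\<lambda>j. nat (int n + j)" "\<lambda>k. int k - int n"])
    fix k assume "k \<in> {..2 * n}"
    have "z ^ k = z powi (int k - int n) * z ^ n"
      by (simp add: power_int_diff)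
    moreover have "q ^ nat ((int k - int n)\<^sup>2) * (q\<^sup>2) ^ (n * k) = (q\<^sup>2) ^ (k choose 2) * q ^ k * q ^ (n\<^sup>2)"
    proof -
      have "nat ((int k - int n)\<^sup>2) + 2 * (n * k) = k\<^sup>2 + n\<^sup>2"
      proof -
        have "int (nat ((int k - int n)\<^sup>2)) = (int k - int n)\<^sup>2"
          by simp
        then have "int (nat ((int k - int n)\<^sup>2) + 2 * (n * k)) = int (k\<^sup>2 + n\<^sup>2)"
          by (simp only: of_nat_add of_nat_mult of_nat_power power2_eq_square)
             (simp add: algebra_simps)
        then show ?thesis
          by (simp only: of_nat_eq_iff)
      qed
      moreover have "2 * (k choose 2) + k = k\<^sup>2"
        by (cases k) (simp_all add: choose_two power2_eq_square)
      ultimately show ?thesis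
        by (simp flip: power_mult power_add)
    qed
    ultimately show "s * (gauss_binomial (q\<^sup>2) (2 * n) (nat (int n + (int k - int n))) *
        (z powi (int k - int n) * q ^ nat ((int k - int n)\<^sup>2))) =
      gauss_binomial (q\<^sup>2) (2 * n) k * (q\<^sup>2) ^ (k choose 2) * x ^ k"
      by (simp add: s_def x_def field_simps flip: power_mult)
  qed auto
  ultimately show ?thesis
    using s by simp
qed

text \<open>Lebesgue's theorem for the counting measure; on absolutely summable families the
  integral agrees with \<open>infsum\<close>.\<close>

lemma infsum_dominated_convergence:
  fixes f :: "'a \<Rightarrow> complex" and h :: "'a \<Rightarrow> real"
  assumes h: "h summable_on UNIV"
    and lim: "\<And>x. (\<lambda>n. s n x) \<longlonglongrightarrow> f x"
    and bound: "\<And>n x. norm (s n x) \<le> h x"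
  shows "(\<lambda>n. \<Sum>\<^sub>\<infinity>x. s n x) \<longlonglongrightarrow> (\<Sum>\<^sub>\<infinity>x. f x)"
proof -
  let ?M = "count_space (UNIV :: 'a set)"
  have h_nonneg: "h x \<ge> 0" for x
    using bound[of 0 x] norm_ge_zero order_trans by blast
  have norm_f: "norm (f x) \<le> h x" for x
    by (rule LIMSEQ_le_const2[OF tendsto_norm[OF lim]]) (use bound in auto)
  have "integrable ?M h"
    using h h_nonneg abs_summable_equivalent[of h UNIV]
    unfolding Infinite_Set_Sum.abs_summable_on_def by simp
  then have "(\<lambda>n. integral\<^sup>L ?M (s n)) \<longlonglongrightarrow> integral\<^sup>L ?M f"
    by (rule integral_dominated_convergence[where w = h, rotated 2]) (use lim bound in auto)
  moreover have "integral\<^sup>L ?M u = (\<Sum>\<^sub>\<infinity>x. u x)" if "\<And>x. norm (u x) \<le> h x" for u :: "'a \<Rightarrow> complex"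
  proof -
    have "(\<lambda>x. norm (u x)) summable_on UNIV"
      by (rule summable_on_comparison_test[OF h]) (use that in auto)
    then have "Infinite_Set_Sum.abs_summable_on u UNIV"
      by (simp add: abs_summable_equivalent)
    then show ?thesis
      using infsetsum_infsum unfolding infsetsum_def by blast
  qed
  ultimately show ?thesis
    using bound norm_f by simp
qed

lemma summable_on_int_if:
  fixes f :: "int \<Rightarrow> real"
  assumes "(\<lambda>n. f (int n)) summable_on UNIV" "(\<lambda>n. f (- int n)) summable_on UNIV"
  shows "f summable_on UNIV"
proof -
  have "f summable_on range int"
    using assms(1) by (subst summable_on_reindex) (auto simp: o_def)
  moreover have "f summable_on range (\<lambda>n. - int n)"
    using assms(2) by (subst summable_on_reindex) (auto simp: o_def inj_on_def)
  ultimately have "f summable_on (range int \<union> range (\<lambda>n. - int n))"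
    by (rule summable_on_union)
  moreover have "range int \<union> range (\<lambda>n. - int n) = UNIV"
  proof -
    have "x \<in> range int \<union> range (\<lambda>n. - int n)" for x
      by (cases x rule: int_cases2) auto
    then show ?thesis by blast
  qed
  ultimately show ?thesis by simp
qed

text \<open>Since \<open>c^n * r^(n^2) = (c * r^n)^n\<close> and \<open>c * r^n\<close> tends to 0,
  the terms are eventually below those of a geometric series of ratio 1/2.\<close>

lemma summable_power_square:
  fixes c r :: real
  assumes "0 \<le> r" "r < 1" "c > 0"
  shows "(\<lambda>n. c ^ n * r ^ (n\<^sup>2)) summable_on UNIV"
proof -
  have "(\<lambda>n. c * r ^ n) \<longlonglongrightarrow> c * 0"
    using assms by (intro tendsto_mult tendsto_const LIMSEQ_realpow_zero)
  then have "eventually (\<lambda>n. c * r ^ n < 1/2) sequentially"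
    by (rule order_tendstoD) simp
  then have "eventually (\<lambda>n. norm (c ^ n * r ^ (n\<^sup>2)) \<le> (1/2) ^ n) sequentially"
  proof eventually_elim
    case (elim n)
    have "c ^ n * r ^ (n\<^sup>2) = (c * r ^ n) ^ n"
      by (simp add: power_mult_distrib power2_eq_square power_mult)
    also have "\<dots> \<le> (1/2) ^ n"
      using elim assms by (intro power_mono) auto
    finally show ?case using assms by simp
  qed
  then have "summable (\<lambda>n. c ^ n * r ^ (n\<^sup>2))"
    by (rule summable_comparison_test_ev) (auto intro: summable_geometric)
  then show ?thesis
    using assms by (intro summable_nonneg_imp_summable_on) auto
qed

lemma summable_on_theta_norm:
  fixes q z :: complex
  assumes "norm q < 1" "z \<noteq> 0"
  shows "(\<lambda>j. norm (z powi j * q ^ nat (j\<^sup>2))) summable_on UNIV"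
proof (rule summable_on_int_if)
  have "nat ((int n)\<^sup>2) = n\<^sup>2" for n
    by (metis nat_int of_nat_power)
  then show "(\<lambda>n. norm (z powi int n * q ^ nat ((int n)\<^sup>2))) summable_on UNIV"
    "(\<lambda>n. norm (z powi (- int n) * q ^ nat ((- int n)\<^sup>2))) summable_on UNIV"
    using summable_power_square[of "norm q" "norm z"] summable_power_square[of "norm q" "inverse (norm z)"] assms
    by (simp_all add: norm_mult norm_power norm_inverse power_int_minus power_inverse)
qed

text \<open>Let \<open>n\<close> tend to infinity in the finite version, with
  \<open>Q = q^2\<close>. For fixed \<open>j\<close> the coefficients tend to
  \<open>1 / euler_phi Q\<close>, and they are bounded uniformly in \<open>n\<close> and
  \<open>j\<close>, so dominated convergence moves the limit inside the sum.\<close>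

theorem jacobi_triple_product:
  fixes q z :: complex
  assumes "norm q < 1" "q \<noteq> 0" "z \<noteq> 0"
  shows "(\<Sum>\<^sub>\<infinity>j. z powi j * q ^ nat (j\<^sup>2))
    = qpoch_inf (- z * q) (q\<^sup>2) * qpoch_inf (- q / z) (q\<^sup>2) * euler_phi (q\<^sup>2)"
proof -
  define Q where "Q = q\<^sup>2"
  have Q: "norm Q < 1"
    using assms by (simp add: Q_def norm_power power_less_one_iff)
  define E where "E = euler_phi Q"
  have E: "E \<noteq> 0"
    using Q by (simp add: E_def euler_phi_nonzero)
  have qfact_lim: "qfact Q \<longlonglongrightarrow> E"
    using qpoch_inf_LIMSEQ[OF Q, of Q] by (simp add: qfact_def [abs_def] E_def euler_phi_def)
  have qfact_nz: "qfact Q n \<noteq> 0" for n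
    using norm_mult_power_less_1[OF Q Q] unfolding qfact_def
    by (auto simp: prod_zero_iff) (metis norm_one less_irrefl)
  obtain B where B: "\<And>n. norm (qfact Q n) \<le> B"
    using convergent_imp_Bseq[of "qfact Q"] qfact_lim by (auto simp: convergent_def Bseq_def)
  have inv_lim: "(\<lambda>n. inverse (qfact Q n)) \<longlonglongrightarrow> inverse E"
    using qfact_lim E by (rule tendsto_inverse)
  then obtain B' where B': "\<And>n. norm (inverse (qfact Q n)) \<le> B'"
    using convergent_imp_Bseq[of "\<lambda>n. inverse (qfact Q n)"] by (auto simp: convergent_def Bseq_def)
  have B_nonneg: "B \<ge> 0" "B' \<ge> 0"
    using B[of 0] B'[of 0] norm_ge_zero order_trans by blast+
  \<comment> \<open>Extension by zero lets all sums range over the same index set, as dominated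
    convergence requires.\<close>
  define b where "b = (\<lambda>n j. if j \<in> {-int n..int n} then gauss_binomial Q (2*n) (nat (int n + j)) else 0)"
  \<comment> \<open>This form yields both the limit \<open>E / (E * E)\<close> and the uniform
    bound, because \<open>qfact Q\<close> and its inverse are bounded sequences.\<close>
  have b_eq: "b n j = qfact Q (2*n) * inverse (qfact Q (nat (int n + j))) * inverse (qfact Q (nat (int n - j)))"
    if "j \<in> {-int n..int n}" for n j
  proof -
    have "nat (int n + j) + nat (int n - j) = 2 * n"
      using that by auto
    then show ?thesis
      using gauss_binomial_mult_qfact[of Q "nat (int n + j)" "nat (int n - j)"] that qfact_nz
      by (simp add: b_def field_simps)
  qed
  have b_bound: "norm (b n j) \<le> B * B' * B'" for n j
  proof (cases "j \<in> {-int n..int n}")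
    case True
    then show ?thesis
      unfolding b_eq[OF True] norm_mult using B B' B_nonneg by (intro mult_mono) auto
  next
    case False
    then have "b n j = 0"
      unfolding b_def by (rule if_not_P)
    then show ?thesis using B_nonneg by simp
  qed
  have b_lim: "(\<lambda>n. b n j) \<longlonglongrightarrow> inverse E" for j
  proof -
    have shift: "filterlim (\<lambda>n. nat (int n + i)) at_top sequentially" for i
      unfolding filterlim_at_top
    proof
      fix M :: nat
      show "eventually (\<lambda>n. M \<le> nat (int n + i)) sequentially"
        using eventually_ge_at_top[of "M + nat \<bar>i\<bar>"] by eventually_elim auto
    qed
    have "filterlim (\<lambda>n::nat. 2 * n) at_top sequentially"
      by (rule filterlim_subseq) (simp add: strict_mono_def)
    then have "(\<lambda>n. qfact Q (2*n) * inverse (qfact Q (nat (int n + j))) * inverse (qfact Q (nat (int n + (- j)))))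
        \<longlonglongrightarrow> E * inverse E * inverse E"
      by (intro tendsto_mult filterlim_compose[OF qfact_lim] filterlim_compose[OF inv_lim] shift)
    then have "(\<lambda>n. qfact Q (2*n) * inverse (qfact Q (nat (int n + j))) * inverse (qfact Q (nat (int n - j))))
        \<longlonglongrightarrow> inverse E"
      using E by simp
    moreover have "eventually (\<lambda>n. b n j = qfact Q (2*n) * inverse (qfact Q (nat (int n + j))) * inverse (qfact Q (nat (int n - j)))) sequentially"
      using eventually_ge_at_top[of "nat \<bar>j\<bar>"] by eventually_elim (rule b_eq, auto)
    ultimately show ?thesis
      by (simp add: tendsto_cong)
  qed
  define t where "t = (\<lambda>j. z powi j * q ^ nat (j\<^sup>2))"
  have "(\<lambda>n. \<Sum>\<^sub>\<infinity>j. b n j * t j) \<longlonglongrightarrow> (\<Sum>\<^sub>\<infinity>j. inverse E * t j)"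
  proof (rule infsum_dominated_convergence)
    show "(\<lambda>j. B * B' * B' * norm (t j)) summable_on UNIV"
      unfolding t_def using summable_on_theta_norm[OF assms(1,3)] by (rule summable_on_cmult_right)
    show "norm (b n j * t j) \<le> B * B' * B' * norm (t j)" for n j
      using b_bound by (simp add: norm_mult mult_right_mono)
  qed (intro tendsto_mult b_lim tendsto_const)
  moreover have "(\<Sum>\<^sub>\<infinity>j. b n j * t j) = (\<Prod>k<n. 1 - (- z * q) * Q ^ k) * (\<Prod>k<n. 1 - (- q / z) * Q ^ k)" for n
  proof -
    have "(\<Sum>\<^sub>\<infinity>j. b n j * t j) = (\<Sum>\<^sub>\<infinity>j\<in>{-int n..int n}. b n j * t j)"
      by (rule infsum_cong_neutral) (auto simp: b_def)
    also have "\<dots> = (\<Sum>j\<in>{-int n..int n}. gauss_binomial Q (2*n) (nat (int n + j)) * t j)"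
      by (simp add: b_def)
    also have "\<dots> = (\<Prod>k<n. 1 + z * q * Q ^ k) * (\<Prod>k<n. 1 + q / z * Q ^ k)"
      unfolding t_def Q_def by (rule finite_jacobi_triple_product[OF assms(2,3), symmetric])
    finally show ?thesis by simp
  qed
  moreover have "(\<lambda>n. (\<Prod>k<n. 1 - (- z * q) * Q ^ k) * (\<Prod>k<n. 1 - (- q / z) * Q ^ k))
      \<longlonglongrightarrow> qpoch_inf (- z * q) Q * qpoch_inf (- q / z) Q"
    by (intro tendsto_mult qpoch_inf_LIMSEQ Q)
  ultimately have "(\<Sum>\<^sub>\<infinity>j. inverse E * t j) = qpoch_inf (- z * q) Q * qpoch_inf (- q / z) Q"
    by (simp add: LIMSEQ_unique)
  then have "(\<Sum>\<^sub>\<infinity>j. t j) = qpoch_inf (- z * q) Q * qpoch_inf (- q / z) Q * E"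
    using E unfolding infsum_cmult_right' by (simp add: field_simps)
  then show ?thesis
    by (simp add: t_def Q_def E_def)
qed

subsection \<open>Quintic dissection of theta series\<close>

text \<open>Fubini's theorem for absolutely summable families. It turns products of theta series
  into sums over lattice points and back.\<close>

lemma
  fixes f :: "'a :: countable \<Rightarrow> complex" and g :: "'b :: countable \<Rightarrow> complex"
  assumes "(\<lambda>x. norm (f x)) summable_on A" "(\<lambda>y. norm (g y)) summable_on B"
  shows summable_on_product: "(\<lambda>(x, y). f x * g y) summable_on A \<times> B"
    and infsum_product: "infsum f A * infsum g B = (\<Sum>\<^sub>\<infinity>(x, y)\<in>A \<times> B. f x * g y)"
proof -
  have "Infinite_Set_Sum.abs_summable_on (\<lambda>(x, y). f x * g y) (A \<times> B)"
    using assms by (intro abs_summable_on_product) (simp_all add: abs_summable_equivalent)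
  then show sum: "(\<lambda>(x, y). f x * g y) summable_on A \<times> B"
    using abs_summable_equivalent abs_summable_summable by blast
  have "(\<Sum>\<^sub>\<infinity>(x, y)\<in>A \<times> B. f x * g y) = (\<Sum>\<^sub>\<infinity>x\<in>A. \<Sum>\<^sub>\<infinity>y\<in>B. f x * g y)"
    by (rule infsum_Sigma'_banach[OF sum, symmetric])
  also have "\<dots> = infsum f A * infsum g B"
    by (simp add: infsum_cmult_right' infsum_cmult_left')
  finally show "infsum f A * infsum g B = (\<Sum>\<^sub>\<infinity>(x, y)\<in>A \<times> B. f x * g y)" ..
qed

text \<open>In Jacobi's notation the weights (1, -1) lead to theta_4 at nome \<open>p\<close>, and
  (0, 1) to theta_2 at nome \<open>p^4\<close>. Negation and multiplication by 5 preserve parity,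
  hence the weight, which allows one treatment of both.\<close>

definition theta_term :: "complex \<Rightarrow> complex \<Rightarrow> complex \<Rightarrow> int \<Rightarrow> complex" where
  "theta_term a b p x = (if even x then a else b) * p ^ nat (x\<^sup>2)"

definition theta :: "complex \<Rightarrow> complex \<Rightarrow> complex \<Rightarrow> complex" where
  "theta a b p = (\<Sum>\<^sub>\<infinity>x. theta_term a b p x)"

text \<open>The residue \<open>r\<close> is meant to lie between 0 and 4; otherwise the sum is
  empty.\<close>

definition theta_class :: "complex \<Rightarrow> complex \<Rightarrow> complex \<Rightarrow> int \<Rightarrow> complex" where
  "theta_class a b p r = (\<Sum>\<^sub>\<infinity>x\<in>{x. x mod 5 = r}. theta_term a b p x)"

lemma theta_term_norm_summable:
  assumes "norm p < 1"
  shows "(\<lambda>x. norm (theta_term a b p x)) summable_on A"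
proof -
  have "(\<lambda>x. (norm a + norm b) * norm (1 powi x * p ^ nat (x\<^sup>2))) summable_on UNIV"
    by (intro summable_on_cmult_right summable_on_theta_norm assms) auto
  then have "(\<lambda>x. norm (theta_term a b p x)) summable_on UNIV"
    by (rule summable_on_comparison_test) (auto simp: theta_term_def norm_mult intro!: mult_right_mono)
  then show ?thesis
    by (rule summable_on_subset_banach) auto
qed

lemma theta_term_summable: "norm p < 1 \<Longrightarrow> theta_term a b p summable_on A"
  using theta_term_norm_summable abs_summable_summable by blast

text \<open>The terms are even in \<open>x\<close>. Hence classes 4 and 3 agree with 1 and 2, and
  only two unknown series remain.\<close>

lemma theta_class_uminus: "theta_class a b p ((- r) mod 5) = theta_class a b p (r mod 5)"
  unfolding theta_class_def
proof (rule infsum_reindex_bij_witness[of _ uminus uminus])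
  fix x :: int
  show "x \<in> {x. x mod 5 = - r mod 5} \<Longrightarrow> - x \<in> {x. x mod 5 = r mod 5}"
    using mod_minus_cong[of x 5 "- r"] by simp
  show "x \<in> {x. x mod 5 = r mod 5} \<Longrightarrow> - x \<in> {x. x mod 5 = - r mod 5}"
    using mod_minus_cong[of x 5 r] by simp
qed (auto simp: theta_term_def)

text \<open>The substitution \<open>x = 5 * y\<close> keeps the parity and turns \<open>x^2\<close>
  into \<open>25 * y^2\<close>.\<close>

lemma theta_class_0: "theta_class a b p 0 = theta a b (p ^ 25)"
  unfolding theta_class_def theta_def
proof (rule infsum_reindex_bij_witness[of _ "\<lambda>y. 5 * y" "\<lambda>x. x div 5"])
  fix x :: int assume "x \<in> {x. x mod 5 = 0}"
  then obtain y where x: "x = 5 * y"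
    by auto
  have "nat (x\<^sup>2) = 25 * nat (y\<^sup>2)"
    by (simp add: x power_mult_distrib nat_mult_distrib)
  then show "theta_term a b (p ^ 25) (x div 5) = theta_term a b p x"
    by (simp add: theta_term_def x power_mult)
qed auto

text \<open>The exponent \<open>x^2\<close> is constant modulo 5 on a residue class. Classes 1 and 2
  thus acquire the factors \<zeta> and \<open>\<zeta>^4\<close>.\<close>

lemma theta_class_root_of_unity:
  assumes "\<zeta> ^ 5 = 1"
  shows "theta_class a b (\<zeta> * p) r = \<zeta> ^ nat (r\<^sup>2 mod 5) * theta_class a b p r"
proof -
  have "theta_term a b (\<zeta> * p) x = \<zeta> ^ nat (r\<^sup>2 mod 5) * theta_term a b p x" if "x mod 5 = r" for x
  proof -
    have "x\<^sup>2 mod 5 = r\<^sup>2 mod 5"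
      using that by (metis power_mod)
    then have "nat (x\<^sup>2) mod 5 = nat (r\<^sup>2 mod 5)"
      by (metis nat_mod_distrib nat_numeral zero_le_numeral zero_le_power2)
    then have "nat (x\<^sup>2) = 5 * (nat (x\<^sup>2) div 5) + nat (r\<^sup>2 mod 5)"
      by (metis mult_div_mod_eq)
    then have "\<zeta> ^ nat (x\<^sup>2) = \<zeta> ^ nat (r\<^sup>2 mod 5)"
      using assms by (metis mult_1 power_add power_mult power_one)
    then show ?thesis
      by (simp add: theta_term_def power_mult_distrib)
  qed
  then show ?thesis
    unfolding theta_class_def by (subst infsum_cmult_right' [symmetric]) (auto intro!: infsum_cong)
qed

lemma mod_5_cases: "(x::int) mod 5 \<in> {0, 1, 2, 3, 4}"
proof -
  have "x mod 5 \<ge> 0" "x mod 5 < 5"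
    by auto
  then show ?thesis
    by auto
qed

lemma theta_dissection:
  assumes "norm p < 1"
  shows "theta a b p = theta a b (p ^ 25) + 2 * theta_class a b p 1 + 2 * theta_class a b p 2"
proof -
  have "theta a b p = infsum (theta_term a b p) (\<Union>r\<in>{0,1,2,3,4}. {x. x mod 5 = r})"
    unfolding theta_def using mod_5_cases by (intro arg_cong[where f = "infsum _"]) auto
  also have "\<dots> = (\<Sum>r\<in>{0,1,2,3,4}. theta_class a b p r)"
    unfolding theta_class_def
    by (rule sum_infsum [symmetric]) (use assms in \<open>auto intro: theta_term_summable\<close>)
  finally show ?thesis
    using theta_class_uminus[of a b p 1] theta_class_uminus[of a b p 2] by (simp add: theta_class_0)
qed

text \<open>
  Multiplication by the Gaussian integer \<open>2 - \<i>\<close>, of norm 5, maps the lattice onto the pairs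
  \<open>(X, Y)\<close> with \<open>X \<equiv> 3 Y (mod 5)\<close> and exchanges the parities of the two coordinates.
\<close>
lemma theta_power2_dissection:
  assumes "norm p < 1"
  shows "theta a b (p ^ 5) ^ 2
    = theta a b (p ^ 25) ^ 2 + 4 * theta_class a b p 1 * theta_class a b p 2"
proof -
  define F where "F = (\<lambda>(x, y). theta_term a b p x * theta_term a b p y)"
  \<comment> \<open>These sets split the image lattice \<open>X \<equiv> 3 * Y (mod 5)\<close> by
    the residue of \<open>Y\<close>; each piece is a product set, so its sum factors.\<close>
  define S where "S = (\<lambda>r::int. {x. x mod 5 = 3 * r mod 5} \<times> {y::int. y mod 5 = r})"
  have p5: "norm (p ^ 5) < 1"
    using assms by (simp add: norm_power power_less_one_iff)
  have "theta a b (p ^ 5) ^ 2 = (\<Sum>\<^sub>\<infinity>(x, y)\<in>UNIV \<times> UNIV. theta_term a b (p ^ 5) x * theta_term a b (p ^ 5) y)"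
    unfolding power2_eq_square theta_def
    by (intro infsum_product theta_term_norm_summable p5)
  also have "\<dots> = infsum F (\<Union>r\<in>{0,1,2,3,4}. S r)"
  proof (rule infsum_reindex_bij_witness[of _ "\<lambda>(X, Y). ((2 * X - Y) div 5, (X + 2 * Y) div 5)"
        "\<lambda>(x, y). (2 * x + y, 2 * y - x)"])
    fix u :: "int \<times> int" assume "u \<in> UNIV \<times> UNIV"
    obtain x y where u: "u = (x, y)"
      by (cases u)
    have "2 * (2 * x + y) - (2 * y - x) = 5 * x" "2 * x + y + 2 * (2 * y - x) = 5 * y"
      by simp_all
    then show "(case case u of (x, y) \<Rightarrow> (2 * x + y, 2 * y - x) of
        (X, Y) \<Rightarrow> ((2 * X - Y) div 5, (X + 2 * Y) div 5)) = u"
      by (simp add: u)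
    have "2 * x + y = 3 * (2 * y - x) + 5 * (x - y)"
      by simp
    then have "(2 * x + y) mod 5 = 3 * ((2 * y - x) mod 5) mod 5"
      by (metis mod_mult_right_eq mod_mult_self2)
    then show "(case u of (x, y) \<Rightarrow> (2 * x + y, 2 * y - x)) \<in> (\<Union>r\<in>{0,1,2,3,4}. S r)"
      using mod_5_cases[of "2 * y - x"] by (auto simp: u S_def)
    have "nat ((2 * x + y)\<^sup>2) + nat ((2 * y - x)\<^sup>2) = nat ((2 * x + y)\<^sup>2 + (2 * y - x)\<^sup>2)"
      by (rule nat_add_distrib [symmetric]) auto
    also have "(2 * x + y)\<^sup>2 + (2 * y - x)\<^sup>2 = 5 * (x\<^sup>2 + y\<^sup>2)"
      by (simp add: power2_eq_square algebra_simps)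
    also have "nat \<dots> = 5 * (nat (x\<^sup>2) + nat (y\<^sup>2))"
      by (simp add: nat_mult_distrib nat_add_distrib)
    finally have "p ^ nat ((2 * x + y)\<^sup>2) * p ^ nat ((2 * y - x)\<^sup>2) = (p ^ 5) ^ nat (x\<^sup>2) * (p ^ 5) ^ nat (y\<^sup>2)"
      by (simp flip: power_add power_mult)
    \<comment> \<open>The number \<open>2 * x + y\<close> has the parity of \<open>y\<close>, and
      \<open>2 * y - x\<close> that of \<open>x\<close>, so the product of the two weights is
      unchanged.\<close>
    then show "F (case u of (x, y) \<Rightarrow> (2 * x + y, 2 * y - x))
        = (case u of (x, y) \<Rightarrow> theta_term a b (p ^ 5) x * theta_term a b (p ^ 5) y)"
      by (simp add: u F_def theta_term_def)
  next
    fix v :: "int \<times> int" assume "v \<in> (\<Union>r\<in>{0,1,2,3,4}. S r)"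
    then obtain X Y where v: "v = (X, Y)" and "X mod 5 = 3 * (Y mod 5) mod 5"
      by (auto simp: S_def)
    then have "X mod 5 = (3 * Y) mod 5"
      by (simp add: mod_mult_right_eq)
    \<comment> \<open>In terms of \<open>Y\<close> and \<open>k\<close>, both divisions by 5 in the
      inverse map are visibly exact.\<close>
    then obtain k where X: "X = 3 * Y + 5 * k"
      by (metis mod_eqE mult.commute add_diff_cancel_left' diff_add_cancel add.commute)
    have "2 * X - Y = 5 * (Y + 2 * k)" "X + 2 * Y = 5 * (Y + k)"
      by (simp_all add: X)
    then have "(2 * X - Y) div 5 = Y + 2 * k" "(X + 2 * Y) div 5 = Y + k"
      by simp_all
    then show "(case case v of (X, Y) \<Rightarrow> ((2 * X - Y) div 5, (X + 2 * Y) div 5) of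
        (x, y) \<Rightarrow> (2 * x + y, 2 * y - x)) = v"
      by (simp add: v X)
  qed auto
  also have "\<dots> = (\<Sum>r\<in>{0,1,2,3,4}. infsum F (S r))"
    by (rule sum_infsum [symmetric])
       (auto simp: S_def F_def intro!: summable_on_product theta_term_norm_summable assms)
  also have "\<dots> = (\<Sum>r\<in>{0,1,2,3,4}. theta_class a b p (3 * r mod 5) * theta_class a b p r)"
    unfolding S_def F_def theta_class_def
    by (intro sum.cong refl infsum_product [symmetric] theta_term_norm_summable assms)
  \<comment> \<open>The residues 1, 2, 3, 4 of \<open>Y\<close> pair the classes (3, 1), (1, 2), (4,
    3), (2, 4). By the symmetry under negation each pair contributes the product of classes 1 and
    2.\<close>
  finally show ?thesis
    using theta_class_uminus[of a b p 1] theta_class_uminus[of a b p 2]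
    by (simp add: theta_class_0 power2_eq_square)
qed

subsection \<open>The modular equation\<close>

text \<open>At \<open>z = -1\<close> the triple product contains \<open>(p; p^2)\<close> twice, and
  sorting factors by parity gives \<open>(p; p^2) (p^2; p^2) = (p; p)\<close>.\<close>

lemma theta_alternating:
  assumes "norm p < 1" "p \<noteq> 0"
  shows "theta 1 (- 1) p * euler_phi (p ^ 2) = euler_phi p ^ 2"
proof -
  have "theta_term 1 (- 1) p = (\<lambda>x. (- 1) powi x * p ^ nat (x\<^sup>2))"
    by (auto simp: theta_term_def power_int_minus_left)
  then have "theta 1 (- 1) p = qpoch_inf p (p\<^sup>2) * qpoch_inf p (p\<^sup>2) * euler_phi (p\<^sup>2)"
    unfolding theta_def using jacobi_triple_product[OF assms, of "- 1"] by simp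
  moreover have "euler_phi p = qpoch_inf p (p\<^sup>2) * euler_phi (p\<^sup>2)"
    unfolding euler_phi_def using qpoch_inf_multisection[OF assms(1), of 2 p]
    by (simp add: numeral_2_eq_2)
  ultimately show ?thesis
    by (simp add: power2_eq_square)
qed

text \<open>For odd \<open>x = 2 * j + 1\<close> one has \<open>x^2 = 4 * (j + j^2) + 1\<close>, so
  the triple product applies with nome and \<open>z\<close> both equal to \<open>Q = p^4\<close>. It
  yields \<open>(-Q^2; Q^2)\<close> and \<open>(-1; Q^2)\<close>; the latter is twice the former
  because its factor at \<open>k = 0\<close> is 2. Finally \<open>(-Q^2; Q^2)\<close> is
  \<open>euler_phi (p^16) / euler_phi (p^8)\<close>.\<close>

lemma theta_odd:
  assumes "norm p < 1" "p \<noteq> 0"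
  shows "theta 0 1 p * euler_phi (p ^ 8) = 2 * p * euler_phi (p ^ 16) ^ 2"
proof -
  define Q where "Q = p ^ 4"
  have Q: "norm Q < 1" "Q \<noteq> 0"
    using assms by (simp_all add: Q_def norm_power power_less_one_iff)
  have Q2: "norm (Q\<^sup>2) < 1"
    using Q by (simp add: norm_power power_less_one_iff)
  have "theta 0 1 p = (\<Sum>\<^sub>\<infinity>x\<in>{x. odd x}. theta_term 0 1 p x)"
    unfolding theta_def by (rule infsum_cong_neutral) (auto simp: theta_term_def)
  also have "\<dots> = (\<Sum>\<^sub>\<infinity>j. p * (Q powi j * Q ^ nat (j\<^sup>2)))"
  proof (rule infsum_reindex_bij_witness[of _ "\<lambda>j. 2 * j + 1" "\<lambda>x. x div 2"])
    fix x :: int assume "x \<in> {x. odd x}"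
    then obtain j where x: "x = 2 * j + 1"
      by (auto elim: oddE)
    have "j \<le> - 1 \<or> j \<ge> 0"
      by linarith
    then have "j * (j + 1) \<ge> 0"
      by (auto intro: mult_nonpos_nonpos)
    then have nonneg: "j + j\<^sup>2 \<ge> 0"
      by (simp add: power2_eq_square algebra_simps)
    have "x\<^sup>2 = 4 * (j + j\<^sup>2) + 1"
      by (simp add: x power2_eq_square algebra_simps)
    then have "nat (x\<^sup>2) = 4 * nat (j + j\<^sup>2) + 1"
      using nonneg by (simp add: nat_add_distrib nat_mult_distrib)
    then have "p ^ nat (x\<^sup>2) = p * Q ^ nat (j + j\<^sup>2)"
      by (simp add: Q_def power_mult)
    also have "Q ^ nat (j + j\<^sup>2) = Q powi (j + j\<^sup>2)"
      using nonneg by (simp add: power_int_def)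
    also have "\<dots> = Q powi j * Q ^ nat (j\<^sup>2)"
      using Q by (simp add: power_int_add) (simp add: power_int_def)
    finally show "p * (Q powi (x div 2) * Q ^ nat ((x div 2)\<^sup>2)) = theta_term 0 1 p x"
      by (simp add: theta_term_def x)
  qed auto
  also have "\<dots> = p * (qpoch_inf (- (Q\<^sup>2)) (Q\<^sup>2) * qpoch_inf (- 1) (Q\<^sup>2) * euler_phi (Q\<^sup>2))"
    using jacobi_triple_product[OF Q Q(2)] Q(2)
    by (simp add: infsum_cmult_right' power2_eq_square)
  also have "qpoch_inf (- 1) (Q\<^sup>2) = 2 * qpoch_inf (- (Q\<^sup>2)) (Q\<^sup>2)"
    unfolding qpoch_inf_def
    using prodinf_split_head[OF convergent_prod_qpoch[OF Q2, of "- 1"]] by (simp add: mult.commute)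
  finally have "theta 0 1 p * euler_phi (Q\<^sup>2) = 2 * p * (euler_phi (Q\<^sup>2) * qpoch_inf (- (Q\<^sup>2)) (Q\<^sup>2)) ^ 2"
    by (simp add: power2_eq_square)
  also have "euler_phi (Q\<^sup>2) * qpoch_inf (- (Q\<^sup>2)) (Q\<^sup>2) = euler_phi ((Q\<^sup>2)\<^sup>2)"
    unfolding euler_phi_def by (rule qpoch_inf_mult_uminus[OF Q2])
  finally show ?thesis
    by (simp add: Q_def flip: power_mult)
qed

text \<open>As \<open>s\<close> and \<open>t\<close> are prime to 5, \<open>\<zeta>^s\<close> and
  \<open>\<zeta>^t\<close> are primitive, and the product formula for \<open>euler_phi\<close>
  applies to numerator and denominator separately. The monomials match because
  \<open>5 * d + 25 * d = 6 * (5 * d)\<close>.\<close>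

lemma prod_eta_quotient_root_of_unity_5:
  fixes \<zeta> p c :: complex and T :: "complex \<Rightarrow> complex"
  assumes \<zeta>: "\<zeta> ^ 5 = 1" "\<zeta> \<noteq> 1" and p: "norm p < 1" "p \<noteq> 0"
    and st: "s mod 5 \<noteq> 0" "t mod 5 \<noteq> 0"
    and T: "\<And>x. norm x < 1 \<Longrightarrow> x \<noteq> 0 \<Longrightarrow> T x * euler_phi (x ^ t) = c * x ^ d * euler_phi (x ^ s) ^ 2"
  shows "(\<Prod>j<5. T (\<zeta> ^ j * p)) * T (p ^ 25) = T (p ^ 5) ^ 6"
proof -
  have norm_\<zeta>: "norm \<zeta> = 1"
    using \<zeta>(1) by (rule norm_root_of_unity_5)
  have norm_less: "norm (p ^ n) < 1" if "n > 0" for n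
    using p that by (simp add: norm_power power_less_one_iff)
  have pos: "s > 0" "t > 0"
    using st by (auto intro: gr0I)
  define E where "E = (\<lambda>n. \<Prod>j<5. euler_phi ((\<zeta> ^ j * p) ^ n))"
  have E: "E n * euler_phi (p ^ (25 * n)) = euler_phi (p ^ (5 * n)) ^ 6" if "n mod 5 \<noteq> 0" for n
  proof -
    have "n > 0"
      using that by (auto intro: gr0I)
    have "(\<zeta> ^ n) ^ 5 = 1"
      using \<zeta>(1) by (metis mult.commute power_mult power_one)
    then have "(\<Prod>j<5. euler_phi ((\<zeta> ^ n) ^ j * p ^ n)) * euler_phi ((p ^ n) ^ 25) = euler_phi ((p ^ n) ^ 5) ^ 6"
      by (rule prod_euler_phi_root_of_unity_5[OF _ power_root_of_unity_5_neq_1[OF \<zeta> that] norm_less[OF \<open>n > 0\<close>]])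
    then show ?thesis
      by (simp add: E_def power_mult_distrib mult.commute flip: power_mult)
  qed
  have T': "T x = c * x ^ d * euler_phi (x ^ s) ^ 2 / euler_phi (x ^ t)"
    if "norm x < 1" "x \<noteq> 0" for x
  proof -
    have "norm (x ^ t) < 1"
      using that pos by (simp add: norm_power power_less_one_iff)
    then show ?thesis
      using T[OF that] euler_phi_nonzero[of "x ^ t"] by (simp add: field_simps)
  qed
  have "\<zeta> \<noteq> 0"
    using \<zeta> by auto
  then have "(\<Prod>j<5. T (\<zeta> ^ j * p))
      = (\<Prod>j<5. c * (\<zeta> ^ j * p) ^ d * euler_phi ((\<zeta> ^ j * p) ^ s) ^ 2 / euler_phi ((\<zeta> ^ j * p) ^ t))"
    using p by (intro prod.cong refl T') (simp_all add: norm_mult norm_power norm_\<zeta>)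
  also have "\<dots> = c ^ 5 * (\<Prod>j<5. \<zeta> ^ j * p) ^ d * E s ^ 2 / E t"
    by (simp add: prod_dividef E_def prod_power_distrib prod.distrib [of _ "\<lambda>_. p", symmetric])
       (simp add: prod.distrib)
  \<comment> \<open>The exponents 0, 1, 2, 3, 4 add up to 10, so the root of unity drops
    out.\<close>
  also have "(\<Prod>j<5. \<zeta> ^ j * p) = (\<zeta> ^ 5) ^ 2 * p ^ 5"
    by (simp add: eval_nat_numeral)
  finally have "(\<Prod>j<5. T (\<zeta> ^ j * p)) = c ^ 5 * p ^ (5 * d) * E s ^ 2 / E t"
    by (simp add: \<zeta>(1) power_mult)
  moreover have "T (p ^ 25) = c * p ^ (25 * d) * euler_phi (p ^ (25 * s)) ^ 2 / euler_phi (p ^ (25 * t))"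
    "T (p ^ 5) = c * p ^ (5 * d) * euler_phi (p ^ (5 * s)) ^ 2 / euler_phi (p ^ (5 * t))"
    using T'[OF norm_less[of 25]] T'[OF norm_less[of 5]] p(2) by (simp_all flip: power_mult)
  ultimately have "(\<Prod>j<5. T (\<zeta> ^ j * p)) * T (p ^ 25)
      = c ^ 6 * (p ^ (5 * d) * p ^ (25 * d)) * (E s * euler_phi (p ^ (25 * s))) ^ 2 / (E t * euler_phi (p ^ (25 * t)))"
    by (simp add: power_mult_distrib eval_nat_numeral mult_ac)
  also have "\<dots> = c ^ 6 * (p ^ (5 * d)) ^ 6 * (euler_phi (p ^ (5 * s)) ^ 6) ^ 2 / euler_phi (p ^ (5 * t)) ^ 6"
    by (simp only: E[OF st(1)] E[OF st(2)] flip: power_add power_mult) simp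
  also have "\<dots> = T (p ^ 5) ^ 6"
    by (simp add: \<open>T (p ^ 5) = _\<close> power_mult_distrib power_divide flip: power_mult)
  finally show ?thesis .
qed

text \<open>Replacing \<open>(a, b)\<close> by \<open>(\<zeta> * a, \<zeta>^4 * b)\<close> permutes
  the factors, so \<open>a\<close> and \<open>b\<close> can enter only through \<open>a^5\<close>,
  \<open>b^5\<close> and \<open>a * b\<close>. The computation pairs the factors for
  \<open>j\<close> and \<open>5 - j\<close>, whose coefficients are the Gaussian periods
  \<open>u\<close> and \<open>v\<close>.\<close>

lemma prod_quintic_resolvent:
  fixes \<zeta> a b c :: complex
  assumes "\<zeta> ^ 5 = 1" "\<zeta> \<noteq> 1"
  shows "(\<Prod>j<5. c + \<zeta> ^ j * a + (\<zeta> ^ j) ^ 4 * b)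
    = c ^ 5 + a ^ 5 + b ^ 5 - 5 * c ^ 3 * (a * b) + 5 * c * (a * b) ^ 2"
proof -
  have sum0: "1 + \<zeta> + \<zeta>^2 + \<zeta>^3 + \<zeta>^4 = 0"
    using assms by (rule sum_root_of_unity_5)
  define u v where "u = \<zeta> + \<zeta> ^ 4" and "v = \<zeta> ^ 2 + \<zeta> ^ 3"
  have uv: "u + v = -1" "u * v = -1"
    using sum0 unfolding u_def v_def by algebra+
  have pow: "\<zeta> ^ 4 * \<zeta> = 1" "\<zeta>^8 = \<zeta>^3" "\<zeta>^12 = \<zeta>^2" "\<zeta>^16 = \<zeta>"
    using assms(1) by algebra+
  have "(\<Prod>j<5. c + \<zeta> ^ j * a + (\<zeta> ^ j) ^ 4 * b) =
      (c + a + b) * ((c + \<zeta> * a + \<zeta>^4 * b) * (c + \<zeta>^4 * a + \<zeta> * b))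
        * ((c + \<zeta>^2 * a + \<zeta>^3 * b) * (c + \<zeta>^3 * a + \<zeta>^2 * b))"
  proof -
    have "{..<5::nat} = {0,1,2,3,4}" by auto
    then show ?thesis by (simp add: pow mult_ac)
  qed
  also have "(c + \<zeta> * a + \<zeta>^4 * b) * (c + \<zeta>^4 * a + \<zeta> * b) = c^2 + u * c * (a + b) + a^2 + b^2 + v * a * b"
    using assms(1) unfolding u_def v_def by algebra
  also have "(c + \<zeta>^2 * a + \<zeta>^3 * b) * (c + \<zeta>^3 * a + \<zeta>^2 * b) = c^2 + v * c * (a + b) + a^2 + b^2 + u * a * b"
    using assms(1) unfolding u_def v_def by algebra
  also have "(c + a + b) * (c^2 + u * c * (a + b) + a^2 + b^2 + v * a * b) * (c^2 + v * c * (a + b) + a^2 + b^2 + u * a * b)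
      = c ^ 5 + a ^ 5 + b ^ 5 - 5 * c ^ 3 * (a * b) + 5 * c * (a * b) ^ 2"
    using uv by algebra
  finally show ?thesis .
qed

lemma ex_root_of_unity_5: "\<exists>\<zeta>::complex. \<zeta> ^ 5 = 1 \<and> \<zeta> \<noteq> 1"
proof (intro exI conjI)
  show "cis (2 * pi / 5) ^ 5 = 1"
    by (simp add: Complex.DeMoivre)
  show "cis (2 * pi / 5) \<noteq> 1"
  proof
    assume "cis (2 * pi / 5) = 1"
    then have "sin (2 * pi / 5) = 0"
      by (metis cis.sel(2) one_complex.sel(2))
    moreover have "sin (2 * pi / 5) > 0"
      by (rule sin_gt_zero) (auto simp: field_simps)
    ultimately show False by simp
  qed
qed

text \<open>Assumption \<open>T\<close> presents the theta series as an eta quotient. This supplies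
  both the product over the roots of unity and the nonvanishing needed to form \<open>x\<close> and
  \<open>y\<close>.\<close>

theorem theta_modular_equation_5:
  assumes p: "norm p < 1" "p \<noteq> 0"
    and st: "s mod 5 \<noteq> 0" "t mod 5 \<noteq> 0"
    and T: "\<And>x. norm x < 1 \<Longrightarrow> x \<noteq> 0 \<Longrightarrow> theta a b x * euler_phi (x ^ t) = c * x ^ d * euler_phi (x ^ s) ^ 2"
    and "c \<noteq> 0"
    and xy: "x = theta a b (p ^ 5) / theta a b p" "y = theta a b (p ^ 25) / theta a b (p ^ 5)"
  shows "x ^ 5 - y = 5 * x * y * R_poly x y"
proof -
  have nz: "theta a b z \<noteq> 0" if "norm z < 1" "z \<noteq> 0" for z
  proof -
    have "s > 0"
      using st by (auto intro: gr0I)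
    then have "norm (z ^ s) < 1"
      using that by (simp add: norm_power power_less_one_iff)
    then show ?thesis
      using T[OF that] euler_phi_nonzero[of "z ^ s"] that \<open>c \<noteq> 0\<close> by auto
  qed
  obtain \<zeta> :: complex where \<zeta>: "\<zeta> ^ 5 = 1" "\<zeta> \<noteq> 1"
    using ex_root_of_unity_5 by blast
  have norm_\<zeta>: "norm \<zeta> = 1"
    using \<zeta>(1) by (rule norm_root_of_unity_5)
  define X Y V where "X = theta a b p" and "Y = theta a b (p ^ 25)" and "V = theta a b (p ^ 5)"
  define A B where "A = 2 * theta_class a b p 1" and "B = 2 * theta_class a b p 2"
  \<comment> \<open>The twist fixes \<open>p^25\<close>; the powers 1 and 4 are the squares of the
    class representatives 1 and 2.\<close>
  have "theta a b (\<zeta> ^ j * p) = Y + \<zeta> ^ j * A + (\<zeta> ^ j) ^ 4 * B" for j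
  proof -
    have \<zeta>j: "(\<zeta> ^ j) ^ 5 = 1"
      using \<zeta>(1) by (metis mult.commute power_mult power_one)
    then have "(\<zeta> ^ j) ^ 25 = 1"
      using power_mult[of "\<zeta> ^ j" 5 5] by simp
    then show ?thesis
      using theta_dissection[of "\<zeta> ^ j * p" a b] p
        theta_class_root_of_unity[OF \<zeta>j, of a b p 1] theta_class_root_of_unity[OF \<zeta>j, of a b p 2]
      by (simp add: norm_mult norm_power norm_\<zeta> power_mult_distrib Y_def A_def B_def mult_ac)
  qed
  then have "(Y ^ 5 + A ^ 5 + B ^ 5 - 5 * Y ^ 3 * (A * B) + 5 * Y * (A * B) ^ 2) * Y = V ^ 6"
    using prod_eta_quotient_root_of_unity_5[OF \<zeta> p st T] prod_quintic_resolvent[OF \<zeta>, of Y A B]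
    by (simp add: Y_def V_def)
  moreover have "A * B = V ^ 2 - Y ^ 2"
    using theta_power2_dissection[OF p(1), of a b] by (simp add: A_def B_def V_def Y_def)
  moreover have "X = Y + A + B"
    using theta_dissection[OF p(1), of a b] by (simp add: X_def A_def B_def Y_def)
  \<comment> \<open>With \<open>S = X - Y = A + B\<close> and \<open>P = A * B\<close>, one has
    \<open>A^5 + B^5 = S^5 - 5 * P * S^3 + 5 * P^2 * S\<close>.\<close>
  ultimately have eq: "(Y ^ 5 + (X - Y) ^ 5 - 5 * (V ^ 2 - Y ^ 2) * (X - Y) ^ 3 + 5 * (V ^ 2 - Y ^ 2) ^ 2 * (X - Y)
      - 5 * Y ^ 3 * (V ^ 2 - Y ^ 2) + 5 * Y * (V ^ 2 - Y ^ 2) ^ 2) * Y = V ^ 6"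
    by algebra
  have "V \<noteq> 0" "X \<noteq> 0"
    unfolding V_def X_def using p by (simp_all add: nz norm_power power_less_one_iff)
  then have xV: "X * x = V" and yV: "Y = y * V"
    by (simp_all add: xy X_def Y_def V_def)
  \<comment> \<open>The relation is homogeneous of degree 6 in \<open>X\<close>, \<open>Y\<close>,
    \<open>V\<close>. Substituting \<open>V = x * X\<close> and \<open>Y = x * y * X\<close>
    extracts the factor \<open>X^6 * x\<close>.\<close>
  have "X ^ 6 * x * (x ^ 5 - y - 5 * x * y * R_poly x y) = 0"
    using eq unfolding R_poly_def yV xV [symmetric] by algebra
  moreover have "x \<noteq> 0"
    using xV \<open>V \<noteq> 0\<close> by auto
  ultimately show ?thesis
    using \<open>X \<noteq> 0\<close> by simp
qed

subsection \<open>Eta quotients as theta quotients\<close>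

lemma norm_qpow_less_1:
  assumes "r > 0" "Im \<tau> > 0"
  shows "norm (qpow r \<tau>) < 1"
  using assms by (simp add: qpow_def)

lemma qpow_nonzero: "qpow r \<tau> \<noteq> 0"
  by (simp add: qpow_def)

lemma qpow_power: "qpow r \<tau> ^ n = qpow (of_nat n * r) \<tau>"
  by (simp add: qpow_def mult_ac flip: exp_of_nat_mult)

lemma qpow_of_nat_mult: "qpow r (of_nat n * \<tau>) = qpow r \<tau> ^ n"
  by (simp add: qpow_def mult_ac flip: exp_of_nat_mult)

lemma dedekind_eta_of_nat_mult:
  "dedekind_eta (of_nat n * \<tau>) = qpow (1/24) \<tau> ^ n * euler_phi (qpow 1 \<tau> ^ n)"
  by (simp add: dedekind_eta_def euler_phi_def qpow_of_nat_mult)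

lemma g_fun_eq_theta:
  assumes "Im \<tau> > 0"
  shows "g_fun \<tau> = (theta 1 (- 1) (qpow 1 \<tau> ^ 5) / theta 1 (- 1) (qpow 1 \<tau>)) ^ 2"
proof -
  define q h where "q = qpow 1 \<tau>" and "h = qpow (1/24) \<tau>"
  have q: "norm q < 1" "q \<noteq> 0" and h: "h \<noteq> 0"
    using assms norm_qpow_less_1[of 1 \<tau>] qpow_nonzero by (auto simp: q_def h_def)
  have norm_less: "norm (q ^ n) < 1" if "n > 0" for n
    using q that by (simp add: norm_power power_less_one_iff)
  have phi_nz: "euler_phi (q ^ n) \<noteq> 0" if "n > 0" for n
    using norm_less[OF that] by (rule euler_phi_nonzero)
  have \<theta>: "theta 1 (- 1) (q ^ n) = euler_phi (q ^ n) ^ 2 / euler_phi (q ^ (2 * n))" if "n > 0" for n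
  proof -
    have "(q ^ n)\<^sup>2 = q ^ (2 * n)"
      by (simp add: mult.commute flip: power_mult)
    then show ?thesis
      using theta_alternating[OF norm_less[OF that]] phi_nz[of "2 * n"] q that by (simp add: field_simps)
  qed
  have \<theta>1: "theta 1 (- 1) q = euler_phi q ^ 2 / euler_phi (q ^ 2)"
    and \<theta>5: "theta 1 (- 1) (q ^ 5) = euler_phi (q ^ 5) ^ 2 / euler_phi (q ^ 10)"
    using \<theta>[of 1] \<theta>[of 5] by simp_all
  \<comment> \<open>The powers of \<open>h = q^(1/24)\<close> cancel, since 2*2 + 5*4 = 1*4 + 10*2 =
    24.\<close>
  have "g_fun \<tau> = (euler_phi (q ^ 2) ^ 2 * euler_phi (q ^ 5) ^ 4) / (euler_phi q ^ 4 * euler_phi (q ^ 10) ^ 2)"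
    using h dedekind_eta_of_nat_mult[of 1 \<tau>] dedekind_eta_of_nat_mult[of 2 \<tau>]
      dedekind_eta_of_nat_mult[of 5 \<tau>] dedekind_eta_of_nat_mult[of 10 \<tau>]
    by (simp add: g_fun_def power_mult_distrib field_simps power_add [of h 4 20, simplified] phi_nz
          euler_phi_nonzero q flip: q_def h_def)
  also have "\<dots> = (theta 1 (- 1) (q ^ 5) / theta 1 (- 1) q) ^ 2"
    unfolding \<theta>1 \<theta>5 by (simp add: power_divide power_mult_distrib mult.commute flip: power_mult)
  finally show ?thesis
    by (simp add: q_def)
qed

text \<open>Everything is expressed through \<open>C n = (q^n; q^10)\<close>, since
  \<open>euler_phi (q^k)\<close> for \<open>k\<close> dividing 10 is the product of \<open>C\<close>
  over the multiples of \<open>k\<close> up to 10. The choice \<open>p = q^(1/8)\<close> makes the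
  arguments \<open>p^8\<close> and \<open>p^16\<close> of \<open>theta_odd\<close> equal to
  \<open>q\<close> and \<open>q^2\<close>.\<close>

lemma U_fun_eq_theta:
  assumes "Im \<tau> > 0"
  shows "U_fun \<tau> = theta 0 1 (qpow (1/8) \<tau> ^ 5) / theta 0 1 (qpow (1/8) \<tau>)"
proof -
  define p q where "p = qpow (1/8) \<tau>" and "q = qpow 1 \<tau>"
  have p: "norm p < 1" "p \<noteq> 0" and q: "norm q < 1" "q \<noteq> 0"
    using assms norm_qpow_less_1[of _ \<tau>] qpow_nonzero by (auto simp: p_def q_def)
  have pq: "p ^ 8 = q"
    by (simp add: p_def q_def qpow_power)
  have norm_less: "norm (x ^ n) < 1" if "n > 0" "norm x < 1" for x :: complex and n
    using that by (simp add: norm_power power_less_one_iff)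
  have phi_nz: "euler_phi (q ^ n) \<noteq> 0" if "n > 0" for n
    using norm_less[OF that q(1)] by (rule euler_phi_nonzero)
  have \<theta>: "theta 0 1 (p ^ n) = 2 * p ^ n * euler_phi (q ^ (2 * n)) ^ 2 / euler_phi (q ^ n)" if "n > 0" for n
  proof -
    have "(p ^ n) ^ 8 = q ^ n" "(p ^ n) ^ 16 = q ^ (2 * n)"
      by (simp_all add: mult.commute flip: pq power_mult)
    then show ?thesis
      using theta_odd[OF norm_less[OF that p(1)]] p phi_nz[OF that] by (simp add: field_simps)
  qed
  define C where "C = (\<lambda>n. qpoch_inf (q ^ n) (q ^ 10))"
  have C_nz: "C n \<noteq> 0" if "n > 0" for n
    unfolding C_def using norm_less[of _ q] q that by (intro qpoch_inf_nonzero) auto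
  have multi: "euler_phi (q ^ k) = (\<Prod>r<m. C (k * Suc r))" if "k * m = 10" for k m
  proof -
    have "k > 0" "m > 0"
      using that by (auto intro: gr0I)
    then have "euler_phi (q ^ k) = (\<Prod>r<m. qpoch_inf (q ^ k * (q ^ k) ^ r) ((q ^ k) ^ m))"
      unfolding euler_phi_def using norm_less q by (intro qpoch_inf_multisection) auto
    then show ?thesis
      unfolding C_def using that by (simp flip: power_mult power_add)
  qed
  have C1: "euler_phi q = C 1 * C 2 * C 3 * C 4 * C 5 * C 6 * C 7 * C 8 * C 9 * C 10"
    using multi[of 1 10] by (simp add: eval_nat_numeral)
  have C2: "euler_phi (q ^ 2) = C 2 * C 4 * C 6 * C 8 * C 10"
    using multi[of 2 5] by (simp add: eval_nat_numeral)
  have C5: "euler_phi (q ^ 5) = C 5 * C 10"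
    using multi[of 5 2] by (simp add: eval_nat_numeral)
  have C10: "euler_phi (q ^ 10) = C 10"
    using multi[of 10 1] by simp
  have "qpow (3/4) \<tau> = p ^ 6" "qpow (1/4) \<tau> = p ^ 2"
    by (simp_all add: p_def qpow_power)
  moreover have "qpow (of_nat n) \<tau> = q ^ n" for n
    by (simp add: q_def qpow_power)
  from this[of 1] this[of 2] this[of 3] this[of 4] this[of 6] this[of 7] this[of 8] this[of 9] this[of 10]
  have "qpow 1 \<tau> = q ^ 1" "qpow 2 \<tau> = q ^ 2" "qpow 3 \<tau> = q ^ 3" "qpow 4 \<tau> = q ^ 4" "qpow 6 \<tau> = q ^ 6"
    "qpow 7 \<tau> = q ^ 7" "qpow 8 \<tau> = q ^ 8" "qpow 9 \<tau> = q ^ 9" "qpow 10 \<tau> = q ^ 10"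
    by simp_all
  ultimately have "U_fun \<tau> = (p ^ 6 * (C 1 * C 9) / (C 4 * C 6)) / (p ^ 2 * (C 2 * C 8) / (C 3 * C 7))"
    unfolding U_fun_def I_fun_def J_fun_def C_def by (simp only:)
  \<comment> \<open>The residues prime to 10 stand in the numerator and the nonzero even ones in the
    denominator; inclusion-exclusion over the divisors of 10 gives these exponents.\<close>
  also have "\<dots> = p ^ 4 * euler_phi (q ^ 10) ^ 2 * euler_phi q / (euler_phi (q ^ 5) * euler_phi (q ^ 2) ^ 2)"
    unfolding C1 C2 C5 C10 using C_nz p by (simp add: field_simps power2_eq_square eval_nat_numeral)
  also have "\<dots> = theta 0 1 (p ^ 5) / theta 0 1 p"
    using \<theta>[of 1] \<theta>[of 5] p by (simp add: power_Suc [of p 4, simplified])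
  finally show ?thesis
    by (simp add: p_def)
qed

section \<open>The modular equations for g and U\<close>

theorem theorem4p6:
  fixes \<tau> :: complex
  assumes "Im \<tau> > 0"
  shows "g_fun \<tau> ^ 5 - g_fun (5*\<tau>) - 5 * g_fun \<tau> * g_fun (5*\<tau>) * P_poly (g_fun \<tau>) (g_fun (5*\<tau>))
           = 25 * g_fun \<tau> ^ 2 * g_fun (5*\<tau>) ^ 2 * Q_poly (g_fun \<tau>) (g_fun (5*\<tau>)) \<and>
         U_fun \<tau> ^ 5 - U_fun (5*\<tau>) = 5 * U_fun \<tau> * U_fun (5*\<tau>) * R_poly (U_fun \<tau>) (U_fun (5*\<tau>))"
proof -
  have \<tau>5: "Im (5 * \<tau>) > 0"
    using assms by simp
  have qpow5: "qpow r (5 * \<tau>) = qpow r \<tau> ^ 5" for r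
    using qpow_of_nat_mult[of r 5] by simp
  define q where "q = qpow 1 \<tau>"
  define x y where "x = theta 1 (- 1) (q ^ 5) / theta 1 (- 1) q"
    and "y = theta 1 (- 1) (q ^ 25) / theta 1 (- 1) (q ^ 5)"
  have "norm q < 1" "q \<noteq> 0"
    using assms norm_qpow_less_1[of 1 \<tau>] qpow_nonzero by (auto simp: q_def)
  then have "x ^ 5 - y = 5 * x * y * R_poly x y"
    \<comment> \<open>The parameters are those of \<open>theta_alternating\<close>, where no
      monomial occurs.\<close>
    by (rule theta_modular_equation_5[where s = 1 and t = 2 and d = 0 and c = 1])
       (simp_all add: theta_alternating x_def y_def)
  moreover have "g_fun \<tau> = x ^ 2" "g_fun (5 * \<tau>) = y ^ 2"
    using g_fun_eq_theta[OF assms] g_fun_eq_theta[OF \<tau>5]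
    by (simp_all add: x_def y_def q_def qpow5 flip: power_mult)
  \<comment> \<open>The equation for \<open>g\<close> is, up to sign, the norm \<open>F(x, y) F(-x, y)\<close> of \<open>F(x, y) = x\<^sup>5 - y - 5 x y R(x, y)\<close>.\<close>
  ultimately have g: "g_fun \<tau> ^ 5 - g_fun (5*\<tau>) - 5 * g_fun \<tau> * g_fun (5*\<tau>) * P_poly (g_fun \<tau>) (g_fun (5*\<tau>))
      = 25 * g_fun \<tau> ^ 2 * g_fun (5*\<tau>) ^ 2 * Q_poly (g_fun \<tau>) (g_fun (5*\<tau>))"
    unfolding P_poly_def Q_poly_def R_poly_def by algebra
  define p where "p = qpow (1/8) \<tau>"
  have "norm p < 1" "p \<noteq> 0"
    using assms norm_qpow_less_1[of "1/8" \<tau>] qpow_nonzero by (auto simp: p_def)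
  then have U: "U_fun \<tau> ^ 5 - U_fun (5*\<tau>) = 5 * U_fun \<tau> * U_fun (5*\<tau>) * R_poly (U_fun \<tau>) (U_fun (5*\<tau>))"
  \<comment> \<open>The parameters are those of \<open>theta_odd\<close>, with the monomial
    \<open>2 * p\<close>.\<close>
  proof (rule theta_modular_equation_5[where s = 16 and t = 8 and d = 1 and c = 2])
    show "U_fun \<tau> = theta 0 1 (p ^ 5) / theta 0 1 p"
      using U_fun_eq_theta[OF assms] by (simp add: p_def)
    show "U_fun (5 * \<tau>) = theta 0 1 (p ^ 25) / theta 0 1 (p ^ 5)"
      using U_fun_eq_theta[OF \<tau>5] by (simp add: p_def qpow5 flip: power_mult)
  qed (simp_all add: theta_odd)
  from g U show ?thesis
    by blast
qed

end
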